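(* Let $G$ be a finite simple connected graph with $m>0$ edges and maximum degree $\Delta$. Then $$DSO(G)\le \sqrt{m^2-\frac{m}{2\Delta^2} M_2(G)}.$$ Equality holds if and only if $G$ is a regular graph.
   Context: For a finite simple graph $G=(V(G),E(G))$, $d_u$ denotes the degree of the vertex $u$. The Diminished Sombor index is $DSO(G)=\sum_{uv\in E(G)}\frac{\sqrt{d_u^2+d_v^2}}{d_u+d_v}$. The second Zagreb index is $M_2(G)=\sum_{uv\in E(G)}d_u d_v$. *)

theory Defs
  imports Complex_Main
begin

definition simple_graph :: "'a set \<Rightarrow> 'a set set \<Rightarrow> bool" where
  "simple_graph V E \<longleftrightarrow> finite V \<and> (\<forall>e\<in>E. e \<subseteq> V \<and> card e = 2)"

definition adj_rel :: "'a set set \<Rightarrow> ('a \<times> 'a) set" where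
  "adj_rel E = {(u, v). {u, v} \<in> E}"

definition connected_graph :: "'a set \<Rightarrow> 'a set set \<Rightarrow> bool" where
  "connected_graph V E \<longleftrightarrow> V \<noteq> {} \<and> (\<forall>u\<in>V. \<forall>v\<in>V. (u, v) \<in> (adj_rel E)\<^sup>*)"

definition degree :: "'a set set \<Rightarrow> 'a \<Rightarrow> nat" where
  "degree E v = card {e \<in> E. v \<in> e}"

definition max_degree :: "'a set \<Rightarrow> 'a set set \<Rightarrow> nat" where
  "max_degree V E = Max (degree E ` V)"

definition regular_graph :: "'a set \<Rightarrow> 'a set set \<Rightarrow> bool" where
  "regular_graph V E \<longleftrightarrow> (\<exists>k. \<forall>v\<in>V. degree E v = k)"

(* An edge is an unordered pair {u, v}, so the symmetric expressions in its two end vertices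
   are written as sums and products over the edge; the two lemmas below spell them out. *)

definition DSO :: "'a set set \<Rightarrow> real" where
  "DSO E = (\<Sum>e\<in>E. sqrt (\<Sum>w\<in>e. (real (degree E w))\<^sup>2) / (\<Sum>w\<in>e. real (degree E w)))"

definition M2 :: "'a set set \<Rightarrow> nat" where
  "M2 E = (\<Sum>e\<in>E. \<Prod>w\<in>e. degree E w)"

lemma DSO_summand:
  assumes "u \<noteq> v"
  shows "sqrt (\<Sum>w\<in>{u, v}. (real (degree E w))\<^sup>2) / (\<Sum>w\<in>{u, v}. real (degree E w)) =
    sqrt ((real (degree E u))\<^sup>2 + (real (degree E v))\<^sup>2) / (real (degree E u) + real (degree E v))"
  using assms by simp

lemma M2_summand:
  assumes "u \<noteq> v"
  shows "(\<Prod>w\<in>{u, v}. degree E w) = degree E u * degree E v"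
  using assms by simp

end

theory Submission
  imports "HOL-Analysis.Convex" Defs
begin

text \<open>
  For an edge with end degrees \<open>a\<close> and \<open>b\<close>, the square of its contribution to the Diminished
  Sombor index is \<open>(a\<^sup>2 + b\<^sup>2) / (a + b)\<^sup>2 = 1 - 2 a b / (a + b)\<^sup>2\<close>. Since \<open>a + b \<le> 2 \<Delta>\<close>, this is at
  most \<open>1 - a b / (2 \<Delta>\<^sup>2)\<close>, and equality forces \<open>a = b = \<Delta>\<close> (\<open>edge_term_bound\<close>). Summing over the
  edges and comparing the sum of the contributions with the sum of their squares by Cauchy-Schwarz
  gives \<open>DSO\<^sup>2 \<le> m (m - M\<^sub>2 / (2 \<Delta>\<^sup>2))\<close>, which is the inequality.

  If equality holds, it holds for every edge, so all end vertices of edges have degree \<open>\<Delta>\<close>. A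
  connected graph with an edge has no isolated vertex (\<open>connected_vertex_in_edge\<close>), so every vertex
  has degree \<open>\<Delta>\<close>. Conversely, in a regular graph every edge contributes \<open>1 / sqrt 2\<close>, and both sides
  equal \<open>m / sqrt 2\<close>.
\<close>

text \<open>After rewriting the left side as \<open>1 - 2 a b / (a + b)\<^sup>2\<close> and the right side as
  \<open>1 - 2 a b / (2 D)\<^sup>2\<close>, only the denominators differ, and \<open>a b > 0\<close> makes the comparison strict
  unless \<open>a + b = 2 D\<close>.\<close>

lemma edge_term_bound:
  fixes a b D :: real
  assumes "0 < a" "a \<le> D" "0 < b" "b \<le> D"
  shows "(sqrt (a\<^sup>2 + b\<^sup>2) / (a + b))\<^sup>2 \<le> 1 - a * b / (2 * D\<^sup>2)" (is ?le)
    and "(sqrt (a\<^sup>2 + b\<^sup>2) / (a + b))\<^sup>2 = 1 - a * b / (2 * D\<^sup>2) \<Longrightarrow> a = D \<and> b = D"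
proof -
  have "(sqrt (a\<^sup>2 + b\<^sup>2) / (a + b))\<^sup>2 = (a\<^sup>2 + b\<^sup>2) / (a + b)\<^sup>2"
    by (simp add: power_divide)
  also have "\<dots> = 1 - 2 * (a * b) / (a + b)\<^sup>2"
  proof -
    have "(a + b)\<^sup>2 \<noteq> 0" using assms by simp
    moreover have "a\<^sup>2 + b\<^sup>2 = (a + b)\<^sup>2 - 2 * (a * b)"
      by (simp add: power2_eq_square algebra_simps)
    ultimately show ?thesis by (simp add: diff_divide_distrib)
  qed
  finally have sq: "(sqrt (a\<^sup>2 + b\<^sup>2) / (a + b))\<^sup>2 = 1 - 2 * (a * b) / (a + b)\<^sup>2" .
  have rhs: "a * b / (2 * D\<^sup>2) = 2 * (a * b) / (2 * D)\<^sup>2"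
    by (simp add: power2_eq_square)
  have ab: "0 < 2 * (a * b)" using assms by simp
  have "(a + b)\<^sup>2 \<le> (2 * D)\<^sup>2" using assms by (intro power_mono) auto
  then show ?le
    unfolding sq rhs using ab assms by (intro diff_left_mono divide_left_mono) auto
  assume "(sqrt (a\<^sup>2 + b\<^sup>2) / (a + b))\<^sup>2 = 1 - a * b / (2 * D\<^sup>2)"
  then have "2 * (a * b) / (a + b)\<^sup>2 = 2 * (a * b) / (2 * D)\<^sup>2"
    unfolding sq rhs by simp
  then have "(a + b)\<^sup>2 = (2 * D)\<^sup>2"
    using ab assms by (simp add: divide_simps split: if_splits)
  then have "a + b = 2 * D"
    by (rule power2_eq_imp_eq) (use assms in auto)
  then show "a = D \<and> b = D" using assms by linarith
qed

text \<open>A walk from the given vertex to an end of some edge either is trivial or starts with an edge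
  at that vertex.\<close>

lemma connected_vertex_in_edge:
  assumes "simple_graph V E" "connected_graph V E" "E \<noteq> {}" "v \<in> V"
  shows "\<exists>e\<in>E. v \<in> e"
proof -
  obtain e where e: "e \<in> E" using assms(3) by blast
  then have "e \<subseteq> V" "e \<noteq> {}" using assms(1) by (auto simp: simple_graph_def)
  then obtain x where x: "x \<in> e" "x \<in> V" by blast
  have "(v, x) \<in> (adj_rel E)\<^sup>*"
    using assms(2,4) x(2) by (auto simp: connected_graph_def)
  then show ?thesis
  proof (cases rule: converse_rtranclE)
    case base
    then show ?thesis using e x by blast
  next
    case (step w)
    then have "{v, w} \<in> E" by (simp add: adj_rel_def)
    then show ?thesis by blast
  qed
qed

lemma simple_graph_finite_edges:
  assumes "simple_graph V E"
  shows "finite E"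
proof -
  have "E \<subseteq> Pow V" "finite V" using assms by (auto simp: simple_graph_def)
  then show ?thesis by (meson finite_Pow_iff finite_subset)
qed

lemma degree_pos_if_in_edge:
  assumes "finite E" "e \<in> E" "v \<in> e"
  shows "0 < degree E v"
  using assms by (auto simp: degree_def card_gt_0_iff)

lemma degree_le_max_degree:
  assumes "finite V" "v \<in> V"
  shows "degree E v \<le> max_degree V E"
  using assms by (simp add: max_degree_def)

theorem theorem3:
  fixes V :: "'a set" and E :: "'a set set" and m \<Delta> :: nat
  assumes "simple_graph V E"
    and "connected_graph V E"
    and "m = card E" and "m > 0"
    and "\<Delta> = max_degree V E"
  shows "DSO E \<le> sqrt ((real m)\<^sup>2 - real m / (2 * (real \<Delta>)\<^sup>2) * real (M2 E)) \<and>
    (DSO E = sqrt ((real m)\<^sup>2 - real m / (2 * (real \<Delta>)\<^sup>2) * real (M2 E)) \<longleftrightarrow> regular_graph V E)"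
proof -
  \<comment> \<open>\<open>f\<close> is the contribution of an edge to the index, \<open>g\<close> the bound on its square.\<close>
  define f where "f e = sqrt (\<Sum>w\<in>e. (real (degree E w))\<^sup>2) / (\<Sum>w\<in>e. real (degree E w))" for e
  define g where "g e = 1 - real (\<Prod>w\<in>e. degree E w) / (2 * (real \<Delta>)\<^sup>2)" for e
  define R where "R = (real m)\<^sup>2 - real m / (2 * (real \<Delta>)\<^sup>2) * real (M2 E)"
  have finV: "finite V" using assms(1) by (simp add: simple_graph_def)
  have finE: "finite E" using assms(1) by (rule simple_graph_finite_edges)
  have E_ne: "E \<noteq> {}" using assms(3,4) by auto
  have DSO: "DSO E = (\<Sum>e\<in>E. f e)" by (simp add: DSO_def f_def)
  have edge: "\<exists>u v. u \<noteq> v \<and> e = {u, v} \<and> u \<in> V \<and> v \<in> V" if "e \<in> E" for e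
  proof -
    have "card e = 2" "e \<subseteq> V" using that assms(1) by (auto simp: simple_graph_def)
    then show ?thesis by (auto simp: card_2_iff)
  qed
  have edge_bound: "(f e)\<^sup>2 \<le> g e"
    and edge_eq: "(f e)\<^sup>2 = g e \<Longrightarrow> \<forall>w\<in>e. degree E w = \<Delta>" if e: "e \<in> E" for e
  proof -
    obtain u v where uv: "u \<noteq> v" "e = {u, v}" "u \<in> V" "v \<in> V" using edge[OF e] by blast
    have deg: "0 < real (degree E u)" "real (degree E u) \<le> real \<Delta>"
              "0 < real (degree E v)" "real (degree E v) \<le> real \<Delta>"
      using degree_pos_if_in_edge[OF finE e] degree_le_max_degree[OF finV] uv assms(5) by auto
    show "(f e)\<^sup>2 \<le> g e"
      using edge_term_bound(1)[OF deg] uv(1,2) by (simp add: f_def g_def)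
    show "\<forall>w\<in>e. degree E w = \<Delta>" if "(f e)\<^sup>2 = g e"
      using edge_term_bound(2)[OF deg] that uv(1,2) by (simp add: f_def g_def)
  qed
  have sum_g: "real m * (\<Sum>e\<in>E. g e) = R"
    by (simp add: g_def R_def M2_def assms(3) sum_subtractf flip: sum_divide_distrib)
      (simp add: power2_eq_square algebra_simps)
  have CS: "(DSO E)\<^sup>2 \<le> real m * (\<Sum>e\<in>E. (f e)\<^sup>2)"
    using sum_squared_le_sum_of_squares[of f E] unfolding DSO assms(3)
    by (simp add: mult.commute)
  have sums: "real m * (\<Sum>e\<in>E. (f e)\<^sup>2) \<le> R"
    unfolding sum_g[symmetric] by (intro mult_left_mono sum_mono edge_bound) auto
  have DSO_nonneg: "0 \<le> DSO E"
    unfolding DSO f_def by (intro sum_nonneg divide_nonneg_nonneg) (auto intro!: sum_nonneg)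
  have le: "DSO E \<le> sqrt R"
    using CS sums by (intro real_le_rsqrt) linarith
  have "DSO E = sqrt R \<longleftrightarrow> regular_graph V E"
  proof
    assume "DSO E = sqrt R"
    moreover have "0 \<le> R" using CS sums zero_le_power2[of "DSO E"] by linarith
    ultimately have "(DSO E)\<^sup>2 = R" by simp
    \<comment> \<open>The chain \<open>CS\<close>, \<open>sums\<close> starts and ends at the same value, so its second step is tight,
      and a tight sum of inequalities is tight in each summand.\<close>
    then have "real m * (\<Sum>e\<in>E. (f e)\<^sup>2) = real m * (\<Sum>e\<in>E. g e)"
      using CS sums sum_g by linarith
    then have "(\<Sum>e\<in>E. (f e)\<^sup>2) = (\<Sum>e\<in>E. g e)" using assms(4) by simp
    then have "(f e)\<^sup>2 = g e" if "e \<in> E" for e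
      using sum_mono_inv[of "\<lambda>e. (f e)\<^sup>2" E g e] edge_bound finE that by blast
    then have "degree E v = \<Delta>" if "v \<in> V" for v
      using connected_vertex_in_edge[OF assms(1,2) E_ne that] edge_eq by blast
    then show "regular_graph V E" by (auto simp: regular_graph_def)
  next
    assume "regular_graph V E"
    then obtain k where k: "\<And>v. v \<in> V \<Longrightarrow> degree E v = k" by (auto simp: regular_graph_def)
    have V_ne: "V \<noteq> {}" using assms(2) by (simp add: connected_graph_def)
    then have "degree E ` V = {k}" using k by force
    then have \<Delta>: "\<Delta> = k" by (simp add: assms(5) max_degree_def)
    have k_pos: "0 < k"
      using V_ne k connected_vertex_in_edge[OF assms(1,2) E_ne] degree_pos_if_in_edge[OF finE]
      by (metis ex_in_conv)
    have vals: "f e = 1 / sqrt 2" "g e = 1 / 2" if e: "e \<in> E" for e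
    proof -
      obtain u v where uv: "u \<noteq> v" "e = {u, v}" "u \<in> V" "v \<in> V" using edge[OF e] by blast
      have "f e = sqrt (2 * (real k)\<^sup>2) / (2 * real k)"
        using uv k by (simp add: f_def)
      also have "\<dots> = 1 / sqrt 2"
        using k_pos by (simp add: real_sqrt_mult field_simps)
      finally show "f e = 1 / sqrt 2" .
      show "g e = 1 / 2"
        using uv k k_pos by (simp add: g_def \<Delta> power2_eq_square)
    qed
    have "(\<Sum>e\<in>E. f e) = (\<Sum>e\<in>E. 1 / sqrt 2)" "(\<Sum>e\<in>E. g e) = (\<Sum>e\<in>E. 1 / 2)"
      by (rule sum.cong[OF refl], erule vals)+
    then have "DSO E = real m / sqrt 2" and "R = (real m)\<^sup>2 / 2"
      by (simp_all add: DSO sum_g[symmetric] assms(3) power2_eq_square)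
    then show "DSO E = sqrt R" by (simp only: real_sqrt_divide real_sqrt_abs abs_of_nat)
  qed
  with le show ?thesis unfolding R_def by blast
qed

end
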